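(* Let $X$ be a Tychonoff space and let $0_X\in C(X)$ be the constant zero-function. The following are equivalent: (a) $C_{kh}(X)$ is submetrizable; (b) $C_{kh}(X)$ has a $G_\delta$-diagonal; (c) each singleton set in $C(X)$ is a $G_\delta$-set in $C_{kh}(X)$; (d) $\{0_X\}$ is a $G_\delta$-set in $C_{kh}(X)$; (e) $X$ is almost $\sigma$-compact; (f) $C_k(X)$ is submetrizable.
   Context: Tychonoff means completely regular and Hausdorff. $C(X)$ is the set of all continuous functions $X\to\mathbb{R}$. For $A\subseteq X$ and $V\subseteq\mathbb{R}$ put $[A,V]^+=\{f\in C(X): f(A)\subseteq V\}$; for $U\subseteq X$ and $r\in\mathbb{R}$ put $[U,r]^-=\{f\in C(X): f^{-1}(r)\cap U\neq\emptyset\}$. $C_k(X)$ is $C(X)$ with the compact-open topology $k$, having subbase all $[A,V]^+$ with $A\subseteq X$ compact and $V\subseteq\mathbb{R}$ open. $C_{kh}(X)$ is $C(X)$ with the bi-compact-open topology $kh$, having subbase all these sets $[A,V]^+$ together with all $[U,r]^-$ with $U\subseteq X$ open and $r\in\mathbb{R}$. A space is submetrizable if it admits a weaker (coarser or equal) metrizable topology, equivalently, if there is a continuous injection of it into a metric space. A space $Y$ has a $G_\delta$-diagonal if $\{(y,y):y\in Y\}$ is a $G_\delta$-set in $Y\times Y$. A space is almost $\sigma$-compact if it has a dense subset that is a countable union of compact sets. *)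

theory Defs
  imports "HOL-Analysis.Analysis"
begin

definition tychonoff_space :: "'a topology \<Rightarrow> bool" where
  "tychonoff_space X \<longleftrightarrow> completely_regular_space X \<and> Hausdorff_space X"

text \<open>Functions on \<open>topspace X\<close> are represented by their extensional representatives
  (equal to \<open>undefined\<close> outside \<open>topspace X\<close>), so that equality in \<open>real_maps X\<close> is
  equality of functions on \<open>topspace X\<close>.\<close>

definition real_maps :: "'a topology \<Rightarrow> ('a \<Rightarrow> real) set" where
  "real_maps X = {f \<in> extensional (topspace X). continuous_map X euclideanreal f}"

definition zero_map :: "'a topology \<Rightarrow> 'a \<Rightarrow> real" where
  "zero_map X = (\<lambda>x\<in>topspace X. 0)"

definition plus_set :: "'a topology \<Rightarrow> 'a set \<Rightarrow> real set \<Rightarrow> ('a \<Rightarrow> real) set" where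
  "plus_set X A V = {f \<in> real_maps X. f ` A \<subseteq> V}"

definition minus_set :: "'a topology \<Rightarrow> 'a set \<Rightarrow> real \<Rightarrow> ('a \<Rightarrow> real) set" where
  "minus_set X U r = {f \<in> real_maps X. f -` {r} \<inter> U \<noteq> {}}"

definition k_subbase :: "'a topology \<Rightarrow> ('a \<Rightarrow> real) set set" where
  "k_subbase X = {plus_set X A V | A V. compactin X A \<and> open V}"

definition kh_subbase :: "'a topology \<Rightarrow> ('a \<Rightarrow> real) set set" where
  "kh_subbase X = k_subbase X \<union> {minus_set X U r | U r. openin X U}"

definition C_k :: "'a topology \<Rightarrow> ('a \<Rightarrow> real) topology" where
  "C_k X = topology_generated_by (k_subbase X)"

definition C_kh :: "'a topology \<Rightarrow> ('a \<Rightarrow> real) topology" where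
  "C_kh X = topology_generated_by (kh_subbase X)"

text \<open>\<open>topology_generated_by\<close> does not add the whole space to the subbase; here it is
  present as \<open>plus_set X {} V\<close>.\<close>

lemma real_maps_in_k_subbase: "real_maps X \<in> k_subbase X"
  unfolding k_subbase_def plus_set_def
  by (rule CollectI, rule exI[of _ "{}"], rule exI[of _ UNIV]) auto

lemma topspace_C_k: "topspace (C_k X) = real_maps X"
  using real_maps_in_k_subbase[of X]
  unfolding C_k_def topology_generated_by_topspace
  by (auto simp: k_subbase_def plus_set_def)

lemma topspace_C_kh: "topspace (C_kh X) = real_maps X"
  using real_maps_in_k_subbase[of X]
  unfolding C_kh_def topology_generated_by_topspace
  by (auto simp: kh_subbase_def k_subbase_def plus_set_def minus_set_def)

definition submetrizable_space :: "'a topology \<Rightarrow> bool" where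
  "submetrizable_space Y \<longleftrightarrow>
     (\<exists>Z. metrizable_space Z \<and> topspace Z = topspace Y \<and>
          (\<forall>U. openin Z U \<longrightarrow> openin Y U))"

definition has_gdelta_diagonal :: "'a topology \<Rightarrow> bool" where
  "has_gdelta_diagonal Y \<longleftrightarrow>
     gdelta_in (prod_topology Y Y) {(y, y) | y. y \<in> topspace Y}"

definition almost_sigma_compact :: "'a topology \<Rightarrow> bool" where
  "almost_sigma_compact X \<longleftrightarrow>
     (\<exists>D. (countable union_of compactin X) D \<and> X closure_of D = topspace X)"

end

theory Submission
  imports Defs
begin

text \<open>
  The implications from submetrizability to a \<open>G\<^sub>\<delta>\<close>-diagonal, from there to \<open>G\<^sub>\<delta>\<close> singletons, and
  from \<^term>\<open>C_k X\<close> to the finer topology \<^term>\<open>C_kh X\<close> are general topology: a metrizable topology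
  is Hausdorff and its closed sets are \<open>G\<^sub>\<delta>\<close>, a \<open>G\<^sub>\<delta>\<close>-set pulls back along continuous maps, and a
  topology coarser than that of \<^term>\<open>C_k X\<close> is also coarser than that of \<^term>\<open>C_kh X\<close>. The
  equivalences with almost \<open>\<sigma>\<close>-compactness need two arguments about function spaces.

  If \<open>f\<close> lies in a \<open>kh\<close>-open set, so does every continuous function agreeing with it on a certain compact
  set (\<open>C_kh_openin_determined_by_compact\<close>): the sets \<open>[A,V]\<^sup>+\<close> look only at the compact set \<open>A\<close>, and to
  stay in \<open>[U,r]\<^sup>-\<close> it suffices to keep the value \<open>r\<close> at one point of \<open>U\<close>. If the zero function is
  the intersection of countably many open sets, the union of the corresponding compact sets is
  therefore a set on which no other continuous function vanishes, and complete regularity makes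
  such a set dense.

  Conversely, if \<open>K\<^sub>0, K\<^sub>1, \<dots>\<close> are compact sets with dense union, then
  \<open>d(f,g) = sup {min (1/(n+1)) |f x - g x| : x \<in> K\<^sub>n}\<close> is a metric, as continuous functions that agree
  on a dense set are equal. Its balls contain compact-open neighbourhoods
  (\<open>openin_C_k_if_openin_capped_sup_dist\<close>), since terms with large \<open>n\<close>
  are small anyway, so that only the compact union of finitely many \<open>K\<^sub>n\<close> matters.
\<close>

section \<open>\<open>G\<^sub>\<delta>\<close>-diagonals and submetrizable spaces\<close>

lemma gdelta_in_continuous_map_preimage:
  assumes f: "continuous_map X Y f" and S: "gdelta_in Y S"
  shows "gdelta_in X {x \<in> topspace X. f x \<in> S}"
proof -
  obtain \<U> where \<U>: "countable \<U>" "\<U> \<subseteq> Collect (openin Y)" "\<Inter>\<U> = S"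
    using S by (auto simp: gdelta_in_alt intersection_of_def)
  define \<V> where "\<V> = insert (topspace X) ((\<lambda>U. {x \<in> topspace X. f x \<in> U}) ` \<U>)"
  have "countable \<V>" "\<V> \<subseteq> Collect (openin X)" "\<Inter>\<V> = {x \<in> topspace X. f x \<in> S}"
    using \<U> openin_continuous_map_preimage[OF f] by (auto simp: \<V>_def)
  then show ?thesis
    unfolding gdelta_in_alt intersection_of_def by blast
qed

lemma submetrizable_space_imp_has_gdelta_diagonal:
  assumes "submetrizable_space Y"
  shows "has_gdelta_diagonal Y"
proof -
  obtain Z where Z: "metrizable_space Z" "topspace Z = topspace Y"
    and coarser: "\<And>U. openin Z U \<Longrightarrow> openin Y U"
    using assms by (auto simp: submetrizable_space_def)
  let ?D = "(\<lambda>y. (y, y)) ` topspace Y"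
  have "closedin (prod_topology Z Z) ?D"
    using Z metrizable_imp_Hausdorff_space[of Z] Hausdorff_space_closedin_diagonal[of Z] by simp
  then have "gdelta_in (prod_topology Z Z) ?D"
    using Z(1) closed_imp_gdelta_in metrizable_space_prod_topology by blast
  moreover have "continuous_map Y Z id"
    using coarser topology_finer_continuous_id[of Z Y] Z(2) by simp
  then have "continuous_map (prod_topology Y Y) (prod_topology Z Z) (\<lambda>p. (fst p, snd p))"
    using continuous_map_compose[OF continuous_map_fst, of Y Z id Y]
      continuous_map_compose[OF continuous_map_snd, of Y Z id Y]
    by (simp add: continuous_map_pairwise o_def)
  ultimately have "gdelta_in (prod_topology Y Y)
      {p \<in> topspace (prod_topology Y Y). (fst p, snd p) \<in> ?D}"
    by (rule gdelta_in_continuous_map_preimage[rotated])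
  moreover have "{p \<in> topspace (prod_topology Y Y). (fst p, snd p) \<in> ?D}
      = {(y, y) | y. y \<in> topspace Y}"
    by auto
  ultimately show ?thesis
    by (simp add: has_gdelta_diagonal_def)
qed

text \<open>The singleton of \<open>y\<close> is the preimage of the diagonal under \<open>x \<mapsto> (x, y)\<close>.\<close>

lemma has_gdelta_diagonal_imp_gdelta_in_singleton:
  assumes "has_gdelta_diagonal Y" and y: "y \<in> topspace Y"
  shows "gdelta_in Y {y}"
proof -
  have "continuous_map Y (prod_topology Y Y) (\<lambda>x. (x, y))"
    using y by (simp add: continuous_map_pairwise o_def)
  then have "gdelta_in Y {x \<in> topspace Y. (x, y) \<in> {(z, z) | z. z \<in> topspace Y}}"
    using assms(1) unfolding has_gdelta_diagonal_def by (rule gdelta_in_continuous_map_preimage)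
  moreover have "{x \<in> topspace Y. (x, y) \<in> {(z, z) | z. z \<in> topspace Y}} = {y}"
    using y by auto
  ultimately show ?thesis by simp
qed

section \<open>The spaces of continuous functions\<close>

lemma zero_map_in_real_maps: "zero_map X \<in> real_maps X"
  by (auto simp: real_maps_def zero_map_def intro: continuous_map_eq[of _ _ "\<lambda>_. 0"])

lemma real_maps_eq_on_dense:
  assumes "f \<in> real_maps X" "g \<in> real_maps X" "X closure_of D = topspace X"
    and "\<And>x. x \<in> D \<Longrightarrow> f x = g x"
  shows "f = g"
proof (rule extensionalityI)
  show "f \<in> extensional (topspace X)" "g \<in> extensional (topspace X)"
    using assms by (auto simp: real_maps_def)
  show "f x = g x" if "x \<in> topspace X" for x
    using forall_in_closure_of_eq[of x X D euclideanreal f g] assms that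
    by (auto simp: real_maps_def)
qed

lemma openin_C_k_imp_openin_C_kh:
  assumes "openin (C_k X) U"
  shows "openin (C_kh X) U"
proof -
  have "generate_topology_on (k_subbase X) U"
    using assms by (simp add: C_k_def openin_topology_generated_by_iff)
  then have "generate_topology_on (kh_subbase X) U"
    by (rule generate_topology_on_coarsest[rotated 2])
      (auto simp: istopology_generate_topology_on kh_subbase_def intro: generate_topology_on.Basis)
  then show ?thesis
    by (simp add: C_kh_def openin_topology_generated_by_iff)
qed

lemma submetrizable_space_C_k_imp_C_kh:
  "submetrizable_space (C_k X) \<Longrightarrow> submetrizable_space (C_kh X)"
  unfolding submetrizable_space_def topspace_C_k topspace_C_kh
  using openin_C_k_imp_openin_C_kh by blast

text \<open>A subbasic set \<open>[U,r]\<^sup>-\<close> containing \<open>f\<close> has a point \<open>x \<in> U\<close> with \<open>f x = r\<close>, and then contains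
  every \<open>g \<in> C(X)\<close> with \<open>g x = f x\<close>; the compact set for a finite intersection is the union of the compact
  sets of its members.\<close>

lemma C_kh_openin_determined_by_compact:
  assumes "openin (C_kh X) G" "f \<in> G"
  obtains K where "compactin X K" "\<And>g. \<lbrakk>g \<in> real_maps X; \<And>x. x \<in> K \<Longrightarrow> g x = f x\<rbrakk> \<Longrightarrow> g \<in> G"
proof -
  have "generate_topology_on (kh_subbase X) G"
    using assms(1) by (simp add: C_kh_def openin_topology_generated_by_iff)
  then have "\<exists>K. compactin X K \<and> (\<forall>g\<in>real_maps X. (\<forall>x\<in>K. g x = f x) \<longrightarrow> g \<in> G)"
    using assms(2)
  proof induction
    case Empty
    then show ?case by simp
  next
    case (Int a b)
    then obtain K L where "compactin X K" "\<forall>g\<in>real_maps X. (\<forall>x\<in>K. g x = f x) \<longrightarrow> g \<in> a"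
      "compactin X L" "\<forall>g\<in>real_maps X. (\<forall>x\<in>L. g x = f x) \<longrightarrow> g \<in> b"
      by blast
    then show ?case
      by (intro exI[of _ "K \<union> L"]) (auto intro: compactin_Un)
  next
    case (UN \<K>)
    then show ?case by (meson UnionE UnionI)
  next
    case (Basis s)
    then consider (plus) A V where "compactin X A" "s = plus_set X A V"
      | (minus) U r where "openin X U" "s = minus_set X U r"
      by (auto simp: kh_subbase_def k_subbase_def)
    then show ?case
    proof cases
      case plus
      then show ?thesis
        using Basis.prems by (intro exI[of _ A]) (auto simp: plus_set_def image_subset_iff)
    next
      case minus
      then obtain x where "x \<in> U" "f x = r"
        using Basis.prems by (auto simp: minus_set_def)
      moreover from this have "x \<in> topspace X"
        using minus openin_subset by blast
      ultimately show ?thesis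
        using minus by (intro exI[of _ "{x}"]) (auto simp: minus_set_def)
    qed
  qed
  then show ?thesis using that by blast
qed

section \<open>From a \<open>G\<^sub>\<delta>\<close>-singleton to almost \<open>\<sigma>\<close>-compactness\<close>

lemma completely_regular_space_dense_if_zero_map_unique:
  assumes X: "completely_regular_space X" and D: "D \<subseteq> topspace X"
    and unique: "\<And>g. \<lbrakk>g \<in> real_maps X; \<And>x. x \<in> D \<Longrightarrow> g x = 0\<rbrakk> \<Longrightarrow> g = zero_map X"
  shows "X closure_of D = topspace X"
proof (rule ccontr)
  assume "X closure_of D \<noteq> topspace X"
  then obtain p where p: "p \<in> topspace X" "p \<notin> X closure_of D"
    using closure_of_subset_topspace[of X D] by blast
  obtain f where f: "continuous_map X euclideanreal f" "f p = 1" "f ` (X closure_of D) \<subseteq> {0}"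
    using iffD1[OF completely_regular_space_gen_alt X, of 1 0] p closedin_closure_of[of X D]
    by (metis DiffI one_neq_zero)
  let ?g = "restrict f (topspace X)"
  have "?g \<in> real_maps X"
    using f(1) by (auto simp: real_maps_def intro: continuous_map_eq)
  moreover have "?g x = 0" if "x \<in> D" for x
    using that f(3) D closure_of_subset[OF D] by auto
  ultimately have "?g = zero_map X"
    by (rule unique)
  then have "?g p = zero_map X p" by simp
  then show False
    using p f(2) by (simp add: zero_map_def)
qed

lemma gdelta_in_zero_map_imp_almost_sigma_compact:
  assumes X: "completely_regular_space X" and gd: "gdelta_in (C_kh X) {zero_map X}"
  shows "almost_sigma_compact X"
proof -
  obtain \<U> where \<U>: "countable \<U>" "\<And>G. G \<in> \<U> \<Longrightarrow> openin (C_kh X) G" "\<Inter>\<U> = {zero_map X}"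
    using gd by (auto simp: gdelta_in_alt intersection_of_def)
  have "\<exists>K. compactin X K \<and> (\<forall>g\<in>real_maps X. (\<forall>x\<in>K. g x = zero_map X x) \<longrightarrow> g \<in> G)"
    if "G \<in> \<U>" for G
    using C_kh_openin_determined_by_compact[OF \<U>(2)[OF that], of "zero_map X"] \<U>(3) that
    by (metis InterD insertI1)
  then obtain K where K: "\<And>G. G \<in> \<U> \<Longrightarrow> compactin X (K G)"
    "\<And>G g. \<lbrakk>G \<in> \<U>; g \<in> real_maps X; \<forall>x\<in>K G. g x = zero_map X x\<rbrakk> \<Longrightarrow> g \<in> G"
    by metis
  define D where "D = \<Union>(K ` \<U>)"
  have D: "D \<subseteq> topspace X"
    using K(1) compactin_subset_topspace by (auto simp: D_def)
  have "X closure_of D = topspace X"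
  proof (rule completely_regular_space_dense_if_zero_map_unique[OF X D])
    fix g assume g: "g \<in> real_maps X" "\<And>x. x \<in> D \<Longrightarrow> g x = 0"
    have "g x = zero_map X x" if "x \<in> D" for x
      using g(2)[OF that] D that by (auto simp: zero_map_def)
    then have "g \<in> \<Inter>\<U>"
      using K(2)[OF _ g(1)] by (force simp: D_def)
    then show "g = zero_map X" using \<U>(3) by simp
  qed
  moreover have "(countable union_of compactin X) D"
    unfolding union_of_def using \<U>(1) K(1) by (intro exI[of _ "K ` \<U>"]) (auto simp: D_def)
  ultimately show ?thesis
    unfolding almost_sigma_compact_def by blast
qed

section \<open>From almost \<open>\<sigma>\<close>-compactness to a metric on \<open>C(X)\<close>\<close>

text \<open>Uniform approximation of \<open>f\<close> on \<open>K\<close> is expressed by finitely many sets \<open>[A,V]\<^sup>+\<close>: \<open>K\<close> is cut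
  into finitely many compact pieces on which \<open>f\<close> oscillates little.\<close>

lemma C_k_uniform_neighbourhood:
  assumes f: "f \<in> real_maps X" and K: "compactin X K" and e: "e > 0"
  obtains W where "openin (C_k X) W" "f \<in> W" "\<And>g x. \<lbrakk>g \<in> W; x \<in> K\<rbrakk> \<Longrightarrow> \<bar>f x - g x\<bar> < e"
proof -
  have cont: "continuous_map X euclideanreal f"
    using f by (simp add: real_maps_def)
  have "compact (f ` K)"
    using image_compactin[OF K cont] by simp
  then obtain T where T: "finite T" "T \<subseteq> f ` K" "f ` K \<subseteq> (\<Union>t\<in>T. ball t (e/3))"
    by (rule compactE_image[of _ "f ` K" "\<lambda>t. ball t (e/3)"]) (use e in auto)
  define A where "A t = {x \<in> topspace X. f x \<in> cball t (e/3)} \<inter> K" for t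
  define W where "W = \<Inter>(insert (real_maps X) ((\<lambda>t. plus_set X (A t) (ball t (2*e/3))) ` T))"
  have "compactin X (A t)" for t
    unfolding A_def using closedin_continuous_map_preimage[OF cont, of "cball t (e/3)"]
    by (intro closed_Int_compactin K) simp
  then have "openin (C_k X) (plus_set X (A t) (ball t (2*e/3)))" for t
    unfolding C_k_def k_subbase_def by (intro topology_generated_by_Basis) blast
  moreover have "openin (C_k X) (real_maps X)"
    by (metis openin_topspace topspace_C_k)
  ultimately have "openin (C_k X) W"
    unfolding W_def using T(1) by (intro openin_Inter) auto
  moreover have "f \<in> W"
    using f e by (auto simp: W_def plus_set_def A_def)
  moreover have "\<bar>f x - g x\<bar> < e" if g: "g \<in> W" and x: "x \<in> K" for g x
  proof -
    obtain t where t: "t \<in> T" "f x \<in> ball t (e/3)"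
      using T(3) x by blast
    then have "x \<in> A t"
      using x compactin_subset_topspace[OF K] by (auto simp: A_def)
    then have "g x \<in> ball t (2*e/3)"
      using g t(1) by (force simp: W_def plus_set_def image_subset_iff simp del: mem_ball)
    then show ?thesis
      using t(2) unfolding mem_ball dist_real_def by linarith
  qed
  ultimately show ?thesis using that by blast
qed

definition capped_differences :: "(nat \<Rightarrow> 'a set) \<Rightarrow> ('a \<Rightarrow> real) \<Rightarrow> ('a \<Rightarrow> real) \<Rightarrow> real set" where
  "capped_differences K f g = {min (inverse (Suc n)) \<bar>f x - g x\<bar> | n x. x \<in> K n}"

text \<open>Inserting \<open>0\<close> gives the supremum a meaning when all \<open>K n\<close> are empty.\<close>

definition capped_sup_dist :: "(nat \<Rightarrow> 'a set) \<Rightarrow> ('a \<Rightarrow> real) \<Rightarrow> ('a \<Rightarrow> real) \<Rightarrow> real" where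
  "capped_sup_dist K f g = Sup (insert 0 (capped_differences K f g))"

lemma bdd_above_capped_differences: "bdd_above (insert 0 (capped_differences K f g))"
proof (rule bdd_aboveI)
  fix y assume "y \<in> insert 0 (capped_differences K f g)"
  then consider "y = 0" | n x where "y = min (inverse (real (Suc n))) \<bar>f x - g x\<bar>"
    by (auto simp: capped_differences_def)
  then show "y \<le> 1"
  proof cases
    case 2
    then have "y \<le> inverse (real (Suc n))" by simp
    also have "\<dots> \<le> 1" by (simp add: field_simps)
    finally show ?thesis .
  qed simp
qed

lemma capped_sup_dist_ge:
  "x \<in> K n \<Longrightarrow> min (inverse (Suc n)) \<bar>f x - g x\<bar> \<le> capped_sup_dist K f g"
  unfolding capped_sup_dist_def
  by (rule cSup_upper[OF _ bdd_above_capped_differences]) (auto simp: capped_differences_def)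

lemma capped_sup_dist_nonneg: "0 \<le> capped_sup_dist K f g"
  unfolding capped_sup_dist_def by (rule cSup_upper[OF _ bdd_above_capped_differences]) simp

lemma capped_sup_dist_le:
  assumes "0 \<le> b" "\<And>n x. x \<in> K n \<Longrightarrow> min (inverse (Suc n)) \<bar>f x - g x\<bar> \<le> b"
  shows "capped_sup_dist K f g \<le> b"
  unfolding capped_sup_dist_def
  by (rule cSup_least) (use assms in \<open>auto simp: capped_differences_def\<close>)

lemma Metric_space_capped_sup_dist:
  assumes dense: "X closure_of (\<Union>n. K n) = topspace X"
  shows "Metric_space (real_maps X) (capped_sup_dist K)"
proof
  fix f g h :: "'a \<Rightarrow> real"
  show "0 \<le> capped_sup_dist K f g"
    by (rule capped_sup_dist_nonneg)
  show "capped_sup_dist K f g = capped_sup_dist K g f"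
    by (simp add: capped_sup_dist_def capped_differences_def abs_minus_commute)
  show "capped_sup_dist K f h \<le> capped_sup_dist K f g + capped_sup_dist K g h"
  proof (rule capped_sup_dist_le)
    fix n x assume x: "x \<in> K n"
    have "min (inverse (Suc n)) \<bar>f x - h x\<bar>
        \<le> min (inverse (Suc n)) \<bar>f x - g x\<bar> + min (inverse (Suc n)) \<bar>g x - h x\<bar>"
      by (auto simp: min_def)
    also have "\<dots> \<le> capped_sup_dist K f g + capped_sup_dist K g h"
      by (intro add_mono capped_sup_dist_ge x)
    finally show "min (inverse (Suc n)) \<bar>f x - h x\<bar> \<le> \<dots>" .
  qed (simp add: capped_sup_dist_nonneg)
  assume fg: "f \<in> real_maps X" "g \<in> real_maps X"
  show "capped_sup_dist K f g = 0 \<longleftrightarrow> f = g"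
  proof
    assume "capped_sup_dist K f g = 0"
    then have "f x = g x" if "x \<in> K n" for n x
      using capped_sup_dist_ge[where K = K, OF that, of f g] by (auto simp: min_le_iff_disj)
    then show "f = g"
      by (intro real_maps_eq_on_dense[OF fg dense]) blast
  next
    assume "f = g"
    then have "capped_sup_dist K f g \<le> 0"
      by (intro capped_sup_dist_le) auto
    then show "capped_sup_dist K f g = 0"
      using capped_sup_dist_nonneg[of K f g] by simp
  qed
qed

text \<open>In a ball of radius \<open>r\<close>, the terms with \<open>1/(n+1) < r/2\<close> impose no condition; the others are
  controlled uniformly on a finite union of the compact sets \<open>K n\<close>.\<close>

lemma openin_C_k_if_openin_capped_sup_dist:
  assumes K: "\<And>n. compactin X (K n)" and dense: "X closure_of (\<Union>n. K n) = topspace X"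
    and U: "openin (Metric_space.mtopology (real_maps X) (capped_sup_dist K)) U"
  shows "openin (C_k X) U"
proof -
  interpret Metric_space "real_maps X" "capped_sup_dist K"
    by (rule Metric_space_capped_sup_dist[OF dense])
  have "\<exists>W. openin (C_k X) W \<and> f \<in> W \<and> W \<subseteq> U" if fU: "f \<in> U" for f
  proof -
    obtain r where r: "r > 0" "mball f r \<subseteq> U"
      using U fU unfolding openin_mtopology by blast
    have f: "f \<in> real_maps X"
      using U fU unfolding openin_mtopology by blast
    obtain N where N: "inverse (real (Suc N)) < r/2"
      using reals_Archimedean[of "r/2"] r by auto
    have "compactin X (\<Union>n<N. K n)"
      by (intro compactin_Union) (use K in auto)
    then obtain W where W: "openin (C_k X) W" "f \<in> W"
      "\<And>g x. \<lbrakk>g \<in> W; x \<in> (\<Union>n<N. K n)\<rbrakk> \<Longrightarrow> \<bar>f x - g x\<bar> < r/2"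
      using C_k_uniform_neighbourhood[OF f, of "\<Union>n<N. K n" "r/2"] r by (metis half_gt_zero)
    have "W \<subseteq> U"
    proof
      fix g assume g: "g \<in> W"
      have "capped_sup_dist K f g \<le> r/2"
      proof (rule capped_sup_dist_le)
        fix n x assume x: "x \<in> K n"
        show "min (inverse (Suc n)) \<bar>f x - g x\<bar> \<le> r/2"
        proof (cases "n < N")
          case True
          then have "\<bar>f x - g x\<bar> < r/2" using W(3)[OF g, of x] x by blast
          then show ?thesis by linarith
        next
          case False
          then have "inverse (real (Suc n)) \<le> inverse (real (Suc N))"
            by (intro le_imp_inverse_le) auto
          then show ?thesis using N by linarith
        qed
      qed (use r in simp)
      moreover have "g \<in> real_maps X"
        using g openin_subset[OF W(1)] topspace_C_k by blast
      ultimately have "g \<in> mball f r"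
        using f r(1) by simp
      then show "g \<in> U" using r(2) by blast
    qed
    then show ?thesis using W by blast
  qed
  then show ?thesis by (subst openin_subopen) blast
qed

lemma almost_sigma_compact_imp_submetrizable_space_C_k:
  assumes "almost_sigma_compact X"
  shows "submetrizable_space (C_k X)"
proof -
  obtain D \<U> where \<U>: "countable \<U>" "\<U> \<subseteq> Collect (compactin X)" "\<Union>\<U> = D"
    and D: "X closure_of D = topspace X"
    using assms by (auto simp: almost_sigma_compact_def union_of_def)
  \<comment> \<open>adjoining the empty set makes the family nonempty, so that a sequence can enumerate it\<close>
  define K where "K = from_nat_into (insert {} \<U>)"
  have range: "range K = insert {} \<U>"
    unfolding K_def using \<U>(1) by (intro range_from_nat_into) auto
  have K: "compactin X (K n)" for n
  proof -
    have "K n \<in> insert {} \<U>" using range by blast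
    then show ?thesis using \<U>(2) by auto
  qed
  have dense: "X closure_of (\<Union>n. K n) = topspace X"
    using D \<U>(3) range by simp
  interpret Metric_space "real_maps X" "capped_sup_dist K"
    by (rule Metric_space_capped_sup_dist[OF dense])
  show ?thesis
    unfolding submetrizable_space_def topspace_C_k
    using openin_C_k_if_openin_capped_sup_dist[OF K dense] metrizable_space_mtopology
      topspace_mtopology by blast
qed

section \<open>The characterization\<close>

theorem theorem3p1:
  fixes X :: "'a topology"
  assumes "tychonoff_space X"
  shows
    "(submetrizable_space (C_kh X) \<longleftrightarrow> has_gdelta_diagonal (C_kh X)) \<and>
     (has_gdelta_diagonal (C_kh X) \<longleftrightarrow> (\<forall>f\<in>real_maps X. gdelta_in (C_kh X) {f})) \<and>
     ((\<forall>f\<in>real_maps X. gdelta_in (C_kh X) {f}) \<longleftrightarrow> gdelta_in (C_kh X) {zero_map X}) \<and>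
     (gdelta_in (C_kh X) {zero_map X} \<longleftrightarrow> almost_sigma_compact X) \<and>
     (almost_sigma_compact X \<longleftrightarrow> submetrizable_space (C_k X))"
proof -
  have "completely_regular_space X"
    using assms by (simp add: tychonoff_space_def)
  note d_imp_e = gdelta_in_zero_map_imp_almost_sigma_compact[OF this]
  have b_imp_c: "\<forall>f\<in>real_maps X. gdelta_in (C_kh X) {f}" if "has_gdelta_diagonal (C_kh X)"
    using has_gdelta_diagonal_imp_gdelta_in_singleton[OF that] by (simp add: topspace_C_kh)
  show ?thesis
    using submetrizable_space_imp_has_gdelta_diagonal[of "C_kh X"] b_imp_c
      zero_map_in_real_maps[of X] d_imp_e almost_sigma_compact_imp_submetrizable_space_C_k[of X]
      submetrizable_space_C_k_imp_C_kh[of X]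
    by blast
qed

end
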